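(* Let $\omega:=\sum_{i\in I}\omega_i\colon G\times B\to\mathrm{Hom}(E,F)$, where for $i\in I$, $h\in G$, $b\in B$, $v\in E_b$ $$\omega_i(h,b)(v):=\begin{cases}\delta\big(\theta_i(h.b,b)^{-1}h,b\big)\,\varphi_i(h.b,b)\,\kappa(h.b,b)(h.v)&(h.b,b)\in\overline U_i,\\0&(h.b,b)\notin\overline U_i.\end{cases}$$ Let $f\in\Gamma(E)$ be a continuous section and let $\tilde f\colon G\times B\to E$, $(h,b)\mapsto h^{-1}.f(h.b)$ be the corresponding Mackey section. Then $$(\omega\star\tilde f)(e,b)=T_\kappa(f)(b)$$ for any $b\in B$.
   Context: $G$ is a Hausdorff topological group with neutral element $e$, and $B$ is a Hausdorff topological space with a continuous left action $(g,b)\mapsto g.b$; $G_b$ is the stabilizer and $G.b\subseteq B$ the orbit of $b$ (subspace topologies). A $G$-equivariant real vector bundle $E\to B$ is a (finite-rank, locally trivial) real vector bundle with a continuous left $G$-action on $E$ such that the projection is $G$-equivariant and each $g\in G$ maps the fiber $E_b$ linearly to $E_{g.b}$. Let $E\to B$ and $F\to B$ be $G$-equivariant real vector bundles; $\Gamma(E)$ denotes continuous sections. Measures: We have three families of locally finite Borel measures $\{\mu_b\colon\mathcal B(G)\to[0,\infty]\}_{b\in B}$, $\{\bar\mu_b\colon\mathcal B(G.b)\to[0,\infty]\}_{b\in B}$, and $\{\nu_b\colon\mathcal B(G_b)\to[0,\infty]\}_{b\in B}$, each $\nu_b$ left-invariant, such that for all $g\in G$, $b\in B$: $\mu_{g.b}=c_{g*}\mu_b$,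 $\nu_{g.b}=c_{g*}\nu_b$ (pushforwards along the conjugations $c_g\colon G\to G$ resp. $c_g\colon G_b\to G_{g.b}$, $h\mapsto ghg^{-1}$), and $\bar\mu_{g.b}=(g.\_)_*\bar\mu_b$ (pushforward along $c\mapsto g.c$). The family $\{\mu_b\}$ is continuous: $b\mapsto\int_G f'\,d\mu_b$ is continuous for every compactly supported continuous $f'\colon G\to\mathbb R$. Moreover, for all $b\in B$ and compactly supported continuous $f'\colon G\to\mathbb R$, $$\int_G f'(h)\,d\mu_b(h)=\int_{G.b}\int_{G_b}f'(kh)\,d\nu_b(h)\,d\bar\mu_b(k.b),$$ where for a point $c\in G.b$ of the outer integration $k$ is any element of $G$ with $k.b=c$ (the inner integral does not depend on the choice, by left-invariance of $\nu_b$). Function $\delta$: $\delta\colon\{(h,b)\in G\times B\mid h\in G_b\}\to[0,\infty)$ is continuous, each $\delta(-,b)\colon G_b\to[0,\infty)$ is compactly supported with $\int_{G_b}\delta(h,b)\,d\nu_b(h)=1$, and $\delta(ghg^{-1},g.b)=\delta(h,b)$ for all $g\in G$, $b\in B$, $h\in G_b$. Kernel: Let $\bigsqcup_{b\in B}G.b:=\{(c,b)\in B\times B\mid c\in G.b\}$ with the subspace topology of $B\times B$. View $E\times B$ and $B\times F$ as vector bundles over $B\times B$, so $\mathrm{Hom}(E\times B,B\times F)$ has fiber $\mathrm{Hom}(E_c,F_b)$ over $(c,b)$. The kernel $\kappa\colon\bigsqcup_{b\in B}G.b\to\mathrm{Hom}(E\times B,B\times F)$ is continuous with $\kappa(c,b)\in\mathrm{Hom}(E_c,F_b)$,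 each $\kappa(-,b)$ on $G.b$ is compactly supported, and $g.\kappa(c,b)(v)=\kappa(g.c,g.b)(g.v)$ for all $g\in G$, $b\in B$, $c\in G.b$, $v\in E_c$. The orbitwise integral transform is $T_\kappa(f)(b):=\int_{G.b}\kappa(c,b)(f(c))\,d\bar\mu_b(c)$. Partition of unity and maps $\theta_i$: $\{\varphi_i\colon\bigsqcup_{b\in B}G.b\to[0,1]\}_{i\in I}$ is a locally finite (continuous) partition of unity that is invariant under the diagonal $G$-action, $U_i:=\varphi_i^{-1}(0,1]$, $\overline U_i$ is its closure in $\bigsqcup_{b\in B}G.b$, and $\{\theta_i\colon\overline U_i\to G\}_{i\in I}$ is a family of continuous maps with $c=\theta_i(c,b).b$ and $g\theta_i(c,b)=\theta_i(g.c,g.b)g$ for all $g\in G$, $i\in I$, $(c,b)\in\overline U_i$. For each $b\in B$ only finitely many of the maps $\omega_i(-,b)$, $i\in I$, are not identically zero, so the sum defining $\omega$ is well-defined. Cross-correlation: $(\omega\star\tilde f)(h,b):=\int_G\omega(k,b)(\tilde f(hk,b))\,d\mu_b(k)$. *)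

theory Defs
  imports "HOL-Analysis.Analysis" "HOL-Algebra.Module"
begin

text \<open>
  A (not necessarily commutative) Hausdorff topological group is a type of the library classes
  topological_group_add and t2_space. The group is therefore written additively:
  \<open>0\<close> is the neutral element, \<open>g + h\<close> the product, \<open>- g\<close> the inverse and
  \<open>g + h - g\<close> the conjugate of \<open>h\<close> by \<open>g\<close>.
\<close>

section \<open>Actions\<close>

definition continuous_left_action ::
    "('g::topological_group_add \<Rightarrow> 'x::topological_space \<Rightarrow> 'x) \<Rightarrow> bool" where
  "continuous_left_action act \<longleftrightarrow>
     (\<forall>x. act 0 x = x) \<and>
     (\<forall>g h x. act (g + h) x = act g (act h x)) \<and>
     continuous_on UNIV (\<lambda>(g, x). act g x)"

definition action_orbit :: "('g \<Rightarrow> 'x \<Rightarrow> 'x) \<Rightarrow> 'x \<Rightarrow> 'x set" where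
  "action_orbit act x = range (\<lambda>g. act g x)"

definition action_stabilizer :: "('g \<Rightarrow> 'x \<Rightarrow> 'x) \<Rightarrow> 'x \<Rightarrow> 'g set" where
  "action_stabilizer act x = {g. act g x = x}"

definition orbit_pairs :: "('g \<Rightarrow> 'x \<Rightarrow> 'x) \<Rightarrow> ('x \<times> 'x) set" where
  "orbit_pairs act = {(c, b). c \<in> action_orbit act b}"


section \<open>Supports and measures\<close>

text \<open>The support is the closure, relative to the subspace \<open>X\<close>, of the points of \<open>X\<close> at which
  the function in question does not vanish; \<open>nz\<close> expresses nonvanishing.\<close>

definition compactly_supported_on :: "'x::topological_space set \<Rightarrow> ('x \<Rightarrow> bool) \<Rightarrow> bool" where
  "compactly_supported_on X nz \<longleftrightarrow> compact (X \<inter> closure {x \<in> X. nz x})"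

text \<open>The Borel sets of a subspace \<open>X\<close> are the traces on \<open>X\<close> of the Borel sets of the ambient
  space. Equality of measurable sets below also forces \<open>space M = X\<close>.\<close>

definition locally_finite_borel_measure_on :: "'x::topological_space set \<Rightarrow> 'x measure \<Rightarrow> bool" where
  "locally_finite_borel_measure_on X M \<longleftrightarrow>
     sets M = sets (restrict_space borel X) \<and>
     (\<forall>x\<in>X. \<exists>U. open U \<and> x \<in> U \<and> emeasure M (U \<inter> X) < \<infinity>)"


section \<open>Real vector bundles\<close>

definition real_field_ring :: "real ring" where
  "real_field_ring = \<lparr>carrier = UNIV, monoid.mult = (*), one = 1, zero = 0, add = (+)\<rparr>"

text \<open>A vector bundle is given by its projection \<open>p\<close> and the vector space structure \<open>V b\<close> of each
  fiber; the \<open>mult\<close> and \<open>one\<close> components of these records are meaningless.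
  \<open>Euclidean_space n\<close> is the library's version of $R^n$ for a natural number \<open>n\<close>: sequences vanishing
  from index \<open>n\<close> on.\<close>

definition local_trivialization ::
    "('e::topological_space \<Rightarrow> 'b::topological_space) \<Rightarrow> ('b \<Rightarrow> (real, 'e) module) \<Rightarrow>
     'b set \<Rightarrow> nat \<Rightarrow> ('e \<Rightarrow> 'b \<times> (nat \<Rightarrow> real)) \<Rightarrow> bool" where
  "local_trivialization p V U n \<Phi> \<longleftrightarrow>
     open U \<and>
     homeomorphic_map (top_of_set (p -` U)) (prod_topology (top_of_set U) (Euclidean_space n)) \<Phi> \<and>
     (\<forall>x\<in>p -` U. fst (\<Phi> x) = p x) \<and>
     (\<forall>b\<in>U. \<forall>x\<in>carrier (V b). \<forall>y\<in>carrier (V b). \<forall>i.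
        snd (\<Phi> (x \<oplus>\<^bsub>V b\<^esub> y)) i = snd (\<Phi> x) i + snd (\<Phi> y) i) \<and>
     (\<forall>b\<in>U. \<forall>r. \<forall>x\<in>carrier (V b). \<forall>i.
        snd (\<Phi> (r \<odot>\<^bsub>V b\<^esub> x)) i = r * snd (\<Phi> x) i)"

definition real_vector_bundle ::
    "('e::topological_space \<Rightarrow> 'b::topological_space) \<Rightarrow> ('b \<Rightarrow> (real, 'e) module) \<Rightarrow> bool" where
  "real_vector_bundle p V \<longleftrightarrow>
     continuous_on UNIV p \<and>
     (\<forall>b. carrier (V b) = p -` {b}) \<and>
     (\<forall>b. Module.module real_field_ring (V b)) \<and>
     (\<forall>b. \<exists>U n \<Phi>. b \<in> U \<and> local_trivialization p V U n \<Phi>)"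

definition fiber_linear :: "(real, 'e) module \<Rightarrow> (real, 'f) module \<Rightarrow> ('e \<Rightarrow> 'f) \<Rightarrow> bool" where
  "fiber_linear V W L \<longleftrightarrow>
     L \<in> carrier V \<rightarrow> carrier W \<and>
     (\<forall>x\<in>carrier V. \<forall>y\<in>carrier V. L (x \<oplus>\<^bsub>V\<^esub> y) = L x \<oplus>\<^bsub>W\<^esub> L y) \<and>
     (\<forall>r. \<forall>x\<in>carrier V. L (r \<odot>\<^bsub>V\<^esub> x) = r \<odot>\<^bsub>W\<^esub> L x)"

definition equivariant_vector_bundle ::
    "('g::topological_group_add \<Rightarrow> 'b::topological_space \<Rightarrow> 'b) \<Rightarrow> ('g \<Rightarrow> 'e::topological_space \<Rightarrow> 'e) \<Rightarrow>
     ('e \<Rightarrow> 'b) \<Rightarrow> ('b \<Rightarrow> (real, 'e) module) \<Rightarrow> bool" where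
  "equivariant_vector_bundle actB actE p V \<longleftrightarrow>
     real_vector_bundle p V \<and>
     continuous_left_action actE \<and>
     (\<forall>g x. p (actE g x) = actB g (p x)) \<and>
     (\<forall>g b. fiber_linear (V b) (V (actB g b)) (actE g))"

definition continuous_section :: "('e::topological_space \<Rightarrow> 'b::topological_space) \<Rightarrow> ('b \<Rightarrow> 'e) \<Rightarrow> bool" where
  "continuous_section p s \<longleftrightarrow> continuous_on UNIV s \<and> (\<forall>b. p (s b) = b)"


section \<open>The bundle \<open>Hom(E \<times> B, B \<times> F)\<close>\<close>

text \<open>Its total space consists of the triples \<open>((c, b), L)\<close> with \<open>L\<close> a linear map from \<open>E\<^sub>c\<close> to
  \<open>F\<^sub>b\<close>, made unique as a function by extensionality off \<open>E\<^sub>c\<close>.\<close>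

definition hom_total ::
    "('b \<Rightarrow> (real, 'e) module) \<Rightarrow> ('b \<Rightarrow> (real, 'f) module) \<Rightarrow> (('b \<times> 'b) \<times> ('e \<Rightarrow> 'f)) set" where
  "hom_total VE VF =
     {((c, b), L). fiber_linear (VE c) (VF b) L \<and> L \<in> extensional (carrier (VE c))}"

text \<open>The coordinate matrix of \<open>L\<close>, a linear map from \<open>E\<^sub>c\<close>, with respect to the local
  trivializations \<open>\<Phi>\<close> of \<open>E\<close> over \<open>U\<close> (rank \<open>n\<close>) and \<open>\<Psi>\<close> of \<open>F\<close> (rank \<open>m\<close>), padded by zeros.\<close>

definition hom_matrix ::
    "('e \<Rightarrow> 'b) \<Rightarrow> 'b set \<Rightarrow> nat \<Rightarrow> ('e \<Rightarrow> 'b \<times> (nat \<Rightarrow> real)) \<Rightarrow>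
     nat \<Rightarrow> ('f \<Rightarrow> 'b \<times> (nat \<Rightarrow> real)) \<Rightarrow> 'b \<Rightarrow> ('e \<Rightarrow> 'f) \<Rightarrow> nat \<Rightarrow> nat \<Rightarrow> real" where
  "hom_matrix pE U n \<Phi> m \<Psi> c L =
     (\<lambda>i j. if i < m \<and> j < n
            then snd (\<Psi> (L (inv_into (pE -` U) \<Phi> (c, \<lambda>k. if k = j then 1 else 0)))) i
            else 0)"

text \<open>The bundle topology: the preimages of open sets under the bundle charts
  \<open>((c, b), L) \<mapsto> ((c, b), matrix of L)\<close> induced by local trivializations of \<open>E\<close> and \<open>F\<close> form a base.\<close>

definition hom_topology ::
    "('e::topological_space \<Rightarrow> 'b::topological_space) \<Rightarrow> ('b \<Rightarrow> (real, 'e) module) \<Rightarrow>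
     ('f::topological_space \<Rightarrow> 'b) \<Rightarrow> ('b \<Rightarrow> (real, 'f) module) \<Rightarrow>
     (('b \<times> 'b) \<times> ('e \<Rightarrow> 'f)) topology" where
  "hom_topology pE VE pF VF = topology_generated_by
     {{((c, b), L) \<in> hom_total VE VF.
         c \<in> U \<and> b \<in> W \<and> ((c, b), hom_matrix pE U n \<Phi> m \<Psi> c L) \<in> Q} |U n \<Phi> W m \<Psi> Q.
       local_trivialization pE VE U n \<Phi> \<and> local_trivialization pF VF W m \<Psi> \<and> open Q}"


section \<open>Integrals with values in a fiber\<close>

text \<open>The integral of a function with values in a finite-dimensional real vector space \<open>V\<close> is taken
  coordinatewise, i.e. it is compatible with every linear functional on \<open>V\<close>.\<close>

definition fiber_functional :: "(real, 'e) module \<Rightarrow> ('e \<Rightarrow> real) \<Rightarrow> bool" where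
  "fiber_functional V l \<longleftrightarrow>
     (\<forall>x\<in>carrier V. \<forall>y\<in>carrier V. l (x \<oplus>\<^bsub>V\<^esub> y) = l x + l y) \<and>
     (\<forall>r. \<forall>x\<in>carrier V. l (r \<odot>\<^bsub>V\<^esub> x) = r * l x)"

definition has_fiber_integral ::
    "'x measure \<Rightarrow> (real, 'e) module \<Rightarrow> ('x \<Rightarrow> 'e) \<Rightarrow> 'e \<Rightarrow> bool" where
  "has_fiber_integral M V u v \<longleftrightarrow>
     u \<in> space M \<rightarrow> carrier V \<and> v \<in> carrier V \<and>
     (\<forall>l. fiber_functional V l \<longrightarrow>
        integrable M (\<lambda>x. l (u x)) \<and> l v = (\<integral>x. l (u x) \<partial>M))"

definition fiber_integrable :: "'x measure \<Rightarrow> (real, 'e) module \<Rightarrow> ('x \<Rightarrow> 'e) \<Rightarrow> bool" where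
  "fiber_integrable M V u \<longleftrightarrow> (\<exists>v. has_fiber_integral M V u v)"

definition fiber_integral :: "'x measure \<Rightarrow> (real, 'e) module \<Rightarrow> ('x \<Rightarrow> 'e) \<Rightarrow> 'e" where
  "fiber_integral M V u = (THE v. has_fiber_integral M V u v)"


section \<open>Orbitwise integral transform and cross-correlation\<close>

definition integral_transform ::
    "('b \<Rightarrow> 'b measure) \<Rightarrow> ('b \<Rightarrow> (real, 'f) module) \<Rightarrow> ('b \<Rightarrow> 'b \<Rightarrow> 'e \<Rightarrow> 'f) \<Rightarrow> ('b \<Rightarrow> 'e) \<Rightarrow> 'b \<Rightarrow> 'f" where
  "integral_transform mubar VF \<kappa> f b = fiber_integral (mubar b) (VF b) (\<lambda>c. \<kappa> c b (f c))"

definition cross_correlation ::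
    "('b \<Rightarrow> 'g::plus measure) \<Rightarrow> ('b \<Rightarrow> (real, 'f) module) \<Rightarrow>
     ('g \<Rightarrow> 'b \<Rightarrow> 'e \<Rightarrow> 'f) \<Rightarrow> ('g \<Rightarrow> 'b \<Rightarrow> 'e) \<Rightarrow> 'g \<Rightarrow> 'b \<Rightarrow> 'f" where
  "cross_correlation mu VF \<omega> ft h b =
     fiber_integral (mu b) (VF b) (\<lambda>k. \<omega> k b (ft (h + k) b))"

definition mackey_section ::
    "('g::uminus \<Rightarrow> 'b \<Rightarrow> 'b) \<Rightarrow> ('g \<Rightarrow> 'e \<Rightarrow> 'e) \<Rightarrow> ('b \<Rightarrow> 'e) \<Rightarrow> 'g \<Rightarrow> 'b \<Rightarrow> 'e" where
  "mackey_section actB actE f h b = actE (- h) (f (actB h b))"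


section \<open>Invariant partitions of unity and the kernel \<open>\<omega>\<close>\<close>

definition invariant_partition_of_unity ::
    "('g \<Rightarrow> 'b::topological_space \<Rightarrow> 'b) \<Rightarrow> 'i set \<Rightarrow> ('i \<Rightarrow> 'b \<times> 'b \<Rightarrow> real) \<Rightarrow> bool" where
  "invariant_partition_of_unity actB I \<phi> \<longleftrightarrow>
     (\<forall>i\<in>I. continuous_on (orbit_pairs actB) (\<phi> i)) \<and>
     (\<forall>i\<in>I. \<forall>x\<in>orbit_pairs actB. 0 \<le> \<phi> i x \<and> \<phi> i x \<le> 1) \<and>
     (\<forall>x\<in>orbit_pairs actB. \<exists>N. open N \<and> x \<in> N \<and>
        finite {i \<in> I. \<exists>y\<in>N \<inter> orbit_pairs actB. \<phi> i y \<noteq> 0}) \<and>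
     (\<forall>x\<in>orbit_pairs actB. supp_sum (\<lambda>i. \<phi> i x) I = 1) \<and>
     (\<forall>i\<in>I. \<forall>g. \<forall>(c, b)\<in>orbit_pairs actB. \<phi> i (actB g c, actB g b) = \<phi> i (c, b))"

definition U_closure ::
    "('g \<Rightarrow> 'b::topological_space \<Rightarrow> 'b) \<Rightarrow> ('b \<times> 'b \<Rightarrow> real) \<Rightarrow> ('b \<times> 'b) set" where
  "U_closure actB \<phi>i = orbit_pairs actB \<inter> closure {x \<in> orbit_pairs actB. 0 < \<phi>i x}"

definition omega_part ::
    "('g::group_add \<Rightarrow> 'b::topological_space \<Rightarrow> 'b) \<Rightarrow> ('g \<Rightarrow> 'e \<Rightarrow> 'e) \<Rightarrow> ('b \<Rightarrow> (real, 'f) module) \<Rightarrow>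
     ('g \<Rightarrow> 'b \<Rightarrow> real) \<Rightarrow> ('b \<Rightarrow> 'b \<Rightarrow> 'e \<Rightarrow> 'f) \<Rightarrow>
     ('b \<times> 'b \<Rightarrow> real) \<Rightarrow> ('b \<times> 'b \<Rightarrow> 'g) \<Rightarrow> 'g \<Rightarrow> 'b \<Rightarrow> 'e \<Rightarrow> 'f" where
  "omega_part actB actE VF \<delta> \<kappa> \<phi>i \<theta>i h b v =
     (if (actB h b, b) \<in> U_closure actB \<phi>i
      then (\<delta> (- \<theta>i (actB h b, b) + h) b * \<phi>i (actB h b, b))
             \<odot>\<^bsub>VF b\<^esub> \<kappa> (actB h b) b (actE h v)
      else \<zero>\<^bsub>VF b\<^esub>)"

text \<open>The sum over \<open>i\<close> ranges over the indices for which \<open>\<omega>\<^sub>i(-, b)\<close> is not identically zero,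
  since \<open>finsum\<close> is only meaningful over finite index sets.\<close>

definition omega ::
    "('g::group_add \<Rightarrow> 'b::topological_space \<Rightarrow> 'b) \<Rightarrow> ('g \<Rightarrow> 'e \<Rightarrow> 'e) \<Rightarrow> ('b \<Rightarrow> (real, 'e) module) \<Rightarrow>
     ('b \<Rightarrow> (real, 'f) module) \<Rightarrow> ('g \<Rightarrow> 'b \<Rightarrow> real) \<Rightarrow> ('b \<Rightarrow> 'b \<Rightarrow> 'e \<Rightarrow> 'f) \<Rightarrow>
     'i set \<Rightarrow> ('i \<Rightarrow> 'b \<times> 'b \<Rightarrow> real) \<Rightarrow> ('i \<Rightarrow> 'b \<times> 'b \<Rightarrow> 'g) \<Rightarrow> 'g \<Rightarrow> 'b \<Rightarrow> 'e \<Rightarrow> 'f" where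
  "omega actB actE VE VF \<delta> \<kappa> I \<phi> \<theta> h b v =
     (\<Oplus>\<^bsub>VF b\<^esub>i\<in>{i \<in> I. \<exists>h'. \<exists>v'\<in>carrier (VE b).
                    omega_part actB actE VF \<delta> \<kappa> (\<phi> i) (\<theta> i) h' b v' \<noteq> \<zero>\<^bsub>VF b\<^esub>}.
        omega_part actB actE VF \<delta> \<kappa> (\<phi> i) (\<theta> i) h b v)"

end

theory Submission
  imports Defs
begin

text \<open>
  Both sides are vector-valued integrals, so it suffices to compare them after applying a linear
  functional \<open>l\<close> of the fiber \<open>F\<^sub>b\<close>. Put \<open>g c = l (\<kappa>(c,b)(f c))\<close>, a continuous compactly supported
  function on the orbit. Since \<open>h.ft(h,b) = f(h.b)\<close>, the \<open>i\<close>-th summand of \<open>l (\<omega>(h,b)(ft(h,b)))\<close> is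
  \<open>\<delta>(\<theta>\<^sub>i(h.b,b)\<inverse>h, b) \<phi>\<^sub>i(h.b,b) g(h.b)\<close>. It is continuous, because \<open>\<phi>\<^sub>i\<close> vanishes on the boundary of
  \<open>U\<^sub>i\<close>, and supported in the compact set \<open>\<theta>\<^sub>i(supp g, b) supp \<delta>(-,b)\<close>. So \<open>\<mu>\<^sub>b\<close> can be disintegrated
  along the orbit map: on the fiber over \<open>c\<close>, left invariance of \<open>\<nu>\<^sub>b\<close> removes \<open>\<theta>\<^sub>i\<close> and \<open>\<delta>\<close> integrates
  to 1, which leaves \<open>\<integral> \<phi>\<^sub>i(c,b) g(c)\<close>. Now sum over the finitely many \<open>i\<close> that matter on \<open>supp g\<close>.
\<close>

section \<open>Coordinates on the fibers of a vector bundle\<close>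

locale bundle_chart =
  fixes p :: "'e::topological_space \<Rightarrow> 'b::topological_space"
    and V :: "'b \<Rightarrow> (real, 'e) module" and U and n and \<Phi>
  assumes vector_bundle: "real_vector_bundle p V" and chart: "local_trivialization p V U n \<Phi>"
begin

definition coord :: "nat \<Rightarrow> 'e \<Rightarrow> real" where
  "coord j x = snd (\<Phi> x) j"

text \<open>The local frame induced by the chart. It is written exactly as the vector inside
  \<open>hom_matrix\<close>, so matrix entries are coordinates of images of frame vectors.\<close>

definition frame :: "nat \<Rightarrow> 'b \<Rightarrow> 'e" where
  "frame j c = inv_into (p -` U) \<Phi> (c, \<lambda>k. if k = j then 1 else 0)"

lemma carrier_fiber: "x \<in> carrier (V c) \<longleftrightarrow> p x = c"
  using vector_bundle by (auto simp: real_vector_bundle_def)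

lemma module_fiber: "Module.module real_field_ring (V c)"
  using vector_bundle by (auto simp: real_vector_bundle_def)

lemma add_closed_fiber:
  "x \<in> carrier (V c) \<Longrightarrow> y \<in> carrier (V c) \<Longrightarrow> x \<oplus>\<^bsub>V c\<^esub> y \<in> carrier (V c)"
  by (meson abelian_groupE(1) module.axioms(2) module_fiber)

lemma smult_closed_fiber: "x \<in> carrier (V c) \<Longrightarrow> r \<odot>\<^bsub>V c\<^esub> x \<in> carrier (V c)"
  using module.smult_closed[OF module_fiber, of r x c] by (simp add: real_field_ring_def)

lemma chart_homeo:
  "homeomorphic_map (top_of_set (p -` U)) (prod_topology (top_of_set U) (Euclidean_space n)) \<Phi>"
  using chart by (simp add: local_trivialization_def)

lemma inj_chart: "inj_on \<Phi> (p -` U)"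
  using homeomorphic_imp_injective_map[OF chart_homeo] by simp

lemma image_chart: "\<Phi> ` (p -` U) = U \<times> {a. \<forall>i\<ge>n. a i = 0}"
  using homeomorphic_imp_surjective_map[OF chart_homeo] by (simp add: topspace_Euclidean_space)

lemma fst_chart: "p x \<in> U \<Longrightarrow> fst (\<Phi> x) = p x"
  using chart by (simp add: local_trivialization_def)

lemma coord_add:
  "c \<in> U \<Longrightarrow> x \<in> carrier (V c) \<Longrightarrow> y \<in> carrier (V c) \<Longrightarrow>
    coord i (x \<oplus>\<^bsub>V c\<^esub> y) = coord i x + coord i y"
  using chart by (simp add: local_trivialization_def coord_def)

lemma coord_smult:
  "c \<in> U \<Longrightarrow> x \<in> carrier (V c) \<Longrightarrow> coord i (r \<odot>\<^bsub>V c\<^esub> x) = r * coord i x"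
  using chart by (simp add: local_trivialization_def coord_def)

lemma fiber_functional_coord: "c \<in> U \<Longrightarrow> fiber_functional (V c) (coord i)"
  by (simp add: fiber_functional_def coord_add coord_smult)

lemma coord_eq_0: 
  assumes "c \<in> U" "x \<in> carrier (V c)" "n \<le> i"
  shows "coord i x = 0"
proof -
  have "\<Phi> x \<in> U \<times> {a. \<forall>i\<ge>n. a i = 0}"
    unfolding image_chart[symmetric] using assms by (auto simp: carrier_fiber)
  then show ?thesis using assms by (auto simp: coord_def)
qed

text \<open>The chart is injective, its first component is the common base point, and coordinates
  from index \<open>n\<close> on vanish; so the first \<open>n\<close> coordinates determine a
  vector of the fiber.\<close>

lemma coord_inject:
  assumes "c \<in> U" "x \<in> carrier (V c)" "y \<in> carrier (V c)" "\<And>i. i < n \<Longrightarrow> coord i x = coord i y"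
  shows "x = y"
proof (rule inj_onD[OF inj_chart])
  have "coord i x = coord i y" for i
    using assms by (cases "i < n") (auto simp: coord_eq_0)
  then have "snd (\<Phi> x) = snd (\<Phi> y)" by (auto simp: coord_def)
  moreover have "fst (\<Phi> x) = fst (\<Phi> y)"
    using assms fst_chart by (metis carrier_fiber)
  ultimately show "\<Phi> x = \<Phi> y" by (rule prod_eqI[rotated])
  show "x \<in> p -` U" "y \<in> p -` U" using assms by (auto simp: carrier_fiber)
qed

lemma inv_chart:
  assumes "c \<in> U" "\<And>i. n \<le> i \<Longrightarrow> a i = 0"
  shows "inv_into (p -` U) \<Phi> (c, a) \<in> carrier (V c)"
    and "coord i (inv_into (p -` U) \<Phi> (c, a)) = a i"
proof -
  have *: "(c, a) \<in> \<Phi> ` (p -` U)" using assms by (simp add: image_chart)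
  have "\<Phi> (inv_into (p -` U) \<Phi> (c, a)) = (c, a)" using * by (rule f_inv_into_f)
  moreover have "p (inv_into (p -` U) \<Phi> (c, a)) \<in> U" using inv_into_into[OF *] by simp
  ultimately show "inv_into (p -` U) \<Phi> (c, a) \<in> carrier (V c)"
    "coord i (inv_into (p -` U) \<Phi> (c, a)) = a i"
    using fst_chart[of "inv_into (p -` U) \<Phi> (c, a)"] by (simp_all add: carrier_fiber coord_def)
qed

lemma frame_carrier: "c \<in> U \<Longrightarrow> j < n \<Longrightarrow> frame j c \<in> carrier (V c)"
  unfolding frame_def by (rule inv_chart) auto

lemma coord_frame: "c \<in> U \<Longrightarrow> j < n \<Longrightarrow> coord i (frame j c) = (if i = j then 1 else 0)"
  unfolding frame_def by (rule inv_chart) auto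

text \<open>The basis property of the frame, in the dual form needed for fiber integrals: a
  functional is a finite combination of the coordinates, with its values on the frame as
  coefficients.\<close>

lemma functional_expansion:
  assumes c: "c \<in> U" and l: "fiber_functional (V c) l" and x: "x \<in> carrier (V c)"
  shows "l x = (\<Sum>j<n. coord j x * l (frame j c))"
proof -
  \<comment> \<open>Induction on a bound \<open>m\<close> past which all coordinates of
    \<open>x\<close> vanish.\<close>
  have "l x = (\<Sum>j<m. coord j x * l (frame j c))"
    if "m \<le> n" "x \<in> carrier (V c)" "\<And>j. m \<le> j \<Longrightarrow> coord j x = 0" for m x
    using that
  proof (induction m arbitrary: x)
    case 0
    \<comment> \<open>A vector with all coordinates zero equals its own zero multiple, so
      homogeneity of \<open>l\<close> gives \<open>l x = 0\<close>.\<close>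
    have "x = 0 \<odot>\<^bsub>V c\<^esub> x"
      by (rule coord_inject[OF c]) (use 0 c in \<open>auto simp: smult_closed_fiber coord_smult\<close>)
    then have "l x = 0 * l x" using l 0 unfolding fiber_functional_def by metis
    then show ?case by simp
  next
    case (Suc m)
    \<comment> \<open>Adding \<open>y\<close> kills coordinate \<open>m\<close> and leaves the
      others unchanged, which lowers the bound by one.\<close>
    define y where "y = (- coord m x) \<odot>\<^bsub>V c\<^esub> frame m c"
    have m: "m < n" using Suc by simp
    have y: "y \<in> carrier (V c)" by (simp add: y_def smult_closed_fiber frame_carrier c m)
    have cy: "coord j y = (if j = m then - coord m x else 0)" for j
      by (simp add: y_def coord_smult frame_carrier coord_frame c m)
    have "l (x \<oplus>\<^bsub>V c\<^esub> y) = (\<Sum>j<m. coord j (x \<oplus>\<^bsub>V c\<^esub> y) * l (frame j c))"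
      by (rule Suc.IH) (use Suc.prems m in \<open>auto simp: c y cy add_closed_fiber coord_add\<close>)
    also have "\<dots> = (\<Sum>j<m. coord j x * l (frame j c))"
      by (rule sum.cong) (auto simp: coord_add c y cy Suc.prems)
    also have "l (x \<oplus>\<^bsub>V c\<^esub> y) = l x - coord m x * l (frame m c)"
      using l Suc.prems y frame_carrier[OF c m] by (simp add: fiber_functional_def y_def)
    finally show ?case by simp
  qed
  from this[of n x] show ?thesis using coord_eq_0 c x by auto
qed

lemma continuous_on_coord: "continuous_on (p -` U) (coord j)"
proof -
  have "continuous_map (top_of_set (p -` U)) (prod_topology (top_of_set U) (Euclidean_space n)) \<Phi>"
    by (rule homeomorphic_imp_continuous_map[OF chart_homeo])
  then have "continuous_map (top_of_set (p -` U)) (Euclidean_space n) (snd \<circ> \<Phi>)"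
    by (rule continuous_map_compose) (rule continuous_map_snd)
  then have "continuous_map (top_of_set (p -` U)) (powertop_real UNIV) (snd \<circ> \<Phi>)"
    by (simp add: Euclidean_space_def continuous_map_in_subtopology)
  then have "continuous_map (top_of_set (p -` U)) euclideanreal (\<lambda>x. (snd \<circ> \<Phi>) x j)"
    by (simp add: continuous_map_componentwise_UNIV)
  then show ?thesis by (simp add: coord_def[abs_def])
qed

text \<open>The vector \<open>v\<close> whose coordinates are the integrals of the coordinates works
  for every functional, since each functional is a finite combination of coordinates and the
  integral is linear.\<close>

lemma fiber_integral_exists:
  assumes c: "c \<in> U" and u: "u \<in> space M \<rightarrow> carrier (V c)"
    and int: "\<And>l. fiber_functional (V c) l \<Longrightarrow> integrable M (\<lambda>x. l (u x))"
  shows "fiber_integrable M (V c) u"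
proof -
  define a where "a j = (\<integral>x. coord j (u x) \<partial>M)" for j
  define v where "v = inv_into (p -` U) \<Phi> (c, a)"
  \<comment> \<open>Without this the pair \<open>(c, a)\<close> need not lie in the range of the
    chart, and \<open>inv_into\<close> would be meaningless there.\<close>
  have "a j = 0" if "n \<le> j" for j
  proof -
    have "a j = (\<integral>x. 0 \<partial>M)" unfolding a_def
      by (rule Bochner_Integration.integral_cong) (use u c that in \<open>auto simp: coord_eq_0 Pi_iff\<close>)
    then show ?thesis by simp
  qed
  note v = inv_chart[where a = a, OF c this, folded v_def]
  have "l v = (\<integral>x. l (u x) \<partial>M)" if l: "fiber_functional (V c) l" for l
  proof -
    have "(\<integral>x. l (u x) \<partial>M) = (\<integral>x. (\<Sum>j<n. coord j (u x) * l (frame j c)) \<partial>M)"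
      by (rule Bochner_Integration.integral_cong)
        (use u in \<open>auto simp: Pi_iff functional_expansion[OF c l]\<close>)
    also have "\<dots> = (\<Sum>j<n. a j * l (frame j c))"
      by (simp add: int fiber_functional_coord c a_def)
    also have "\<dots> = l v" by (simp add: functional_expansion[OF c l v(1)] v)
    finally show ?thesis by simp
  qed
  then have "has_fiber_integral M (V c) u v"
    using u int v(1) by (simp add: has_fiber_integral_def)
  then show ?thesis by (auto simp: fiber_integrable_def)
qed

lemma has_fiber_integral_unique:
  assumes c: "c \<in> U" and "has_fiber_integral M (V c) u v" "has_fiber_integral M (V c) u w"
  shows "v = w"
proof (rule coord_inject[OF c])
  show "coord i v = coord i w" for i
    using assms(2,3) fiber_functional_coord[OF c, of i] by (metis has_fiber_integral_def)
qed (use assms(2,3) in \<open>simp_all add: has_fiber_integral_def\<close>)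

end

section \<open>Fiber integrals and functionals without reference to a chart\<close>

lemma real_vector_bundle_chart:
  assumes "real_vector_bundle p V"
  obtains U n \<Phi> where "b \<in> U" "bundle_chart p V U n \<Phi>"
  using assms unfolding real_vector_bundle_def bundle_chart_def by blast

lemma fiber_integrableI:
  assumes "real_vector_bundle p V" "u \<in> space M \<rightarrow> carrier (V b)"
    and "\<And>l. fiber_functional (V b) l \<Longrightarrow> integrable M (\<lambda>x. l (u x))"
  shows "fiber_integrable M (V b) u"
proof -
  obtain U n \<Phi> where b: "b \<in> U" and "bundle_chart p V U n \<Phi>"
    using real_vector_bundle_chart[OF assms(1)] .
  then interpret bundle_chart p V U n \<Phi> by simp
  show ?thesis using b assms(2,3) by (rule fiber_integral_exists)
qed

lemma fiber_integral_eqI: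
  assumes "real_vector_bundle p V" "has_fiber_integral M (V b) u v"
  shows "fiber_integral M (V b) u = v"
proof -
  obtain U n \<Phi> where b: "b \<in> U" and "bundle_chart p V U n \<Phi>"
    using real_vector_bundle_chart[OF assms(1)] .
  then interpret bundle_chart p V U n \<Phi> by simp
  show ?thesis
    unfolding fiber_integral_def using assms(2) has_fiber_integral_unique[OF b]
    by (blast intro: the_equality)
qed

lemma module_functional:
  assumes "Module.module real_field_ring V" and l: "fiber_functional V l"
  shows module_functional_zero: "l \<zero>\<^bsub>V\<^esub> = 0"
    and module_functional_finsum: "g \<in> S \<rightarrow> carrier V \<Longrightarrow> finite S \<Longrightarrow> l (finsum V g S) = (\<Sum>i\<in>S. l (g i))"
proof -
  interpret module real_field_ring V by fact
  have "l (\<zero>\<^bsub>V\<^esub> \<oplus>\<^bsub>V\<^esub> \<zero>\<^bsub>V\<^esub>) = l \<zero>\<^bsub>V\<^esub> + l \<zero>\<^bsub>V\<^esub>"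
    using l M.zero_closed unfolding fiber_functional_def by blast
  then show 0: "l \<zero>\<^bsub>V\<^esub> = 0" by simp
  show "l (finsum V g S) = (\<Sum>i\<in>S. l (g i))" if "g \<in> S \<rightarrow> carrier V" "finite S"
    using that(2,1)
  proof (induction S rule: finite_induct)
    case empty
    then show ?case by (simp add: 0)
  next
    case (insert i S)
    then have "finsum V g S \<in> carrier V" by auto
    with insert l show ?case by (simp add: fiber_functional_def Pi_iff)
  qed
qed

section \<open>Continuity of the kernel in local frames\<close>

lemma hom_matrix_continuous:
  fixes pE :: "'e::topological_space \<Rightarrow> 'b::topological_space" and pF :: "'f::topological_space \<Rightarrow> 'b"
  assumes E: "bundle_chart pE VE U n \<Phi>" and F: "bundle_chart pF VF W m \<Psi>" and b: "b \<in> W"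
    and lin: "\<And>c b. (c, b) \<in> X \<Longrightarrow> fiber_linear (VE c) (VF b) (\<kappa> c b)"
    and cont: "continuous_map (top_of_set X) (hom_topology pE VE pF VF)
        (\<lambda>(c, b). ((c, b), restrict (\<kappa> c b) (carrier (VE c))))"
    and ij: "i < m" "j < n"
  shows "continuous_on ({c. (c, b) \<in> X} \<inter> U)
    (\<lambda>c. bundle_chart.coord \<Psi> i (\<kappa> c b (bundle_chart.frame pE U \<Phi> j c)))"
    (is "continuous_on ?A ?g")
  unfolding continuous_on_open_invariant
proof (intro allI impI)
  interpret E: bundle_chart pE VE U n \<Phi> by fact
  interpret F: bundle_chart pF VF W m \<Psi> by fact
  fix S :: "real set" assume "open S"
  \<comment> \<open>\<open>Q\<close> constrains the single matrix entry \<open>(i, j)\<close> to lie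
    in \<open>S\<close>. It is open because evaluation at an entry is continuous, so the set
    \<open>T\<close> cut out by it is a generator of the Hom topology.\<close>
  define Q :: "(('b \<times> 'b) \<times> (nat \<Rightarrow> nat \<Rightarrow> real)) set" where "Q = (\<lambda>z. snd z i j) -` S"
  have "continuous_on UNIV (\<lambda>z :: ('b \<times> 'b) \<times> (nat \<Rightarrow> nat \<Rightarrow> real). snd z i j)"
    by (rule continuous_on_product_then_coordinatewise[
          OF continuous_on_product_then_coordinatewise[OF continuous_on_snd[OF continuous_on_id]]])
  then have "open Q" unfolding Q_def using \<open>open S\<close> by (rule open_vimage[rotated])
  define T where "T = {((c, b), L) \<in> hom_total VE VF.
         c \<in> U \<and> b \<in> W \<and> ((c, b), hom_matrix pE U n \<Phi> m \<Psi> c L) \<in> Q}"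
  have "openin (hom_topology pE VE pF VF) T"
    unfolding hom_topology_def T_def
    by (rule topology_generated_by_Basis) (use E.chart F.chart \<open>open Q\<close> in blast)
  then have "openin (top_of_set X)
      {x \<in> X. (case x of (c, b) \<Rightarrow> ((c, b), restrict (\<kappa> c b) (carrier (VE c)))) \<in> T}"
    using openin_continuous_map_preimage[OF cont] by simp
  then obtain N where N: "open N"
    "{x \<in> X. (case x of (c, b) \<Rightarrow> ((c, b), restrict (\<kappa> c b) (carrier (VE c)))) \<in> T} = X \<inter> N"
    by (auto simp: openin_open)
  have "(c, b) \<in> N \<longleftrightarrow> ?g c \<in> S" if c: "(c, b) \<in> X" "c \<in> U" for c
  proof -
    have "hom_matrix pE U n \<Phi> m \<Psi> c (restrict (\<kappa> c b) (carrier (VE c))) i j = ?g c"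
      using E.frame_carrier[OF c(2) ij(2)] ij
      by (simp add: hom_matrix_def F.coord_def E.frame_def)
    moreover have "((c, b), restrict (\<kappa> c b) (carrier (VE c))) \<in> hom_total VE VF"
      using lin[OF c(1)] E.add_closed_fiber E.smult_closed_fiber
      by (auto simp: hom_total_def fiber_linear_def)
    ultimately have "((c, b), restrict (\<kappa> c b) (carrier (VE c))) \<in> T \<longleftrightarrow> ?g c \<in> S"
      using c b by (simp add: T_def Q_def)
    then show ?thesis using arg_cong[OF N(2), of "\<lambda>A. (c, b) \<in> A"] c(1) by simp
  qed
  \<comment> \<open>Slicing \<open>N\<close> at the fixed second coordinate \<open>b\<close> turns
    openness in pairs into openness in \<open>c\<close>.\<close>
  then have "((\<lambda>c. (c, b)) -` N) \<inter> ?A = ?g -` S \<inter> ?A" by auto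
  moreover have "open ((\<lambda>c. (c, b)) -` N)"
    by (intro open_vimage N continuous_intros)
  ultimately show "\<exists>A. open A \<and> A \<inter> ?A = ?g -` S \<inter> ?A" by blast
qed

text \<open>Near each point the function is a finite sum of products of coordinates of
  \<open>f\<close>, matrix entries of the kernel and the constants \<open>l (F.frame i b)\<close>.
  The chart of \<open>E\<close> depends on the point, so continuity is shown pointwise.\<close>

lemma hom_section_apply_continuous:
  fixes pE :: "'e::topological_space \<Rightarrow> 'b::topological_space" and pF :: "'f::topological_space \<Rightarrow> 'b"
  assumes E: "real_vector_bundle pE VE" and F: "real_vector_bundle pF VF"
    and lin: "\<And>c b. (c, b) \<in> X \<Longrightarrow> fiber_linear (VE c) (VF b) (\<kappa> c b)"
    and cont: "continuous_map (top_of_set X) (hom_topology pE VE pF VF)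
        (\<lambda>(c, b). ((c, b), restrict (\<kappa> c b) (carrier (VE c))))"
    and f: "continuous_section pE f" and l: "fiber_functional (VF b) l"
  shows "continuous_on {c. (c, b) \<in> X} (\<lambda>c. l (\<kappa> c b (f c)))"
    (is "continuous_on ?A ?g")
  unfolding continuous_on_def
proof
  obtain W m \<Psi> where b: "b \<in> W" and F: "bundle_chart pF VF W m \<Psi>"
    using real_vector_bundle_chart[OF F] .
  then interpret F: bundle_chart pF VF W m \<Psi> by simp
  fix c0 assume c0: "c0 \<in> ?A"
  obtain U n \<Phi> where "c0 \<in> U" and E: "bundle_chart pE VE U n \<Phi>"
    using real_vector_bundle_chart[OF E] .
  then interpret E: bundle_chart pE VE U n \<Phi> by simp
  have "open U" using E.chart by (simp add: local_trivialization_def)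
  have g: "(\<Sum>i<m. (\<Sum>j<n. E.coord j (f c) * F.coord i (\<kappa> c b (E.frame j c))) * l (F.frame i b)) = ?g c"
    if c: "c \<in> ?A \<inter> U" for c
  proof -
    have L: "fiber_linear (VE c) (VF b) (\<kappa> c b)" using lin c by simp
    have fc: "f c \<in> carrier (VE c)"
      using f by (simp add: continuous_section_def E.carrier_fiber)
    have "F.coord i (\<kappa> c b (f c)) = (\<Sum>j<n. E.coord j (f c) * F.coord i (\<kappa> c b (E.frame j c)))" for i
      by (rule E.functional_expansion[of c "\<lambda>x. F.coord i (\<kappa> c b x)"])
        (use L c fc b in \<open>auto simp: fiber_functional_def fiber_linear_def F.coord_add F.coord_smult Pi_iff\<close>)
    moreover have "\<kappa> c b (f c) \<in> carrier (VF b)"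
      using L fc by (auto simp: fiber_linear_def)
    ultimately show ?thesis using F.functional_expansion[OF b l] by simp
  qed
  have "f ` (?A \<inter> U) \<subseteq> pE -` U" using f by (auto simp: continuous_section_def)
  moreover have "continuous_on (?A \<inter> U) f"
    using f continuous_on_subset by (auto simp: continuous_section_def)
  ultimately have "continuous_on (?A \<inter> U) (\<lambda>c. E.coord j (f c))" for j
    by (metis E.continuous_on_coord continuous_on_compose2)
  then have "continuous_on (?A \<inter> U)
      (\<lambda>c. \<Sum>i<m. (\<Sum>j<n. E.coord j (f c) * F.coord i (\<kappa> c b (E.frame j c))) * l (F.frame i b))"
    by (intro continuous_intros hom_matrix_continuous[OF E F b lin cont]) auto
  then have "continuous_on (?A \<inter> U) ?g" by (rule continuous_on_eq) (rule g)
  then have "(?g \<longlongrightarrow> ?g c0) (at c0 within ?A \<inter> U)"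
    using c0 \<open>c0 \<in> U\<close> unfolding continuous_on_def by blast
  \<comment> \<open>\<open>U\<close> is an open neighbourhood of \<open>c0\<close>, so restricting
    to it does not change the limit.\<close>
  moreover have "at c0 within ?A \<inter> U = at c0 within ?A"
    by (rule at_within_nhd[OF \<open>c0 \<in> U\<close> \<open>open U\<close>]) auto
  ultimately show "(?g \<longlongrightarrow> ?g c0) (at c0 within ?A)" by simp
qed

section \<open>Locally finite measures\<close>

lemma space_locally_finite:
  "locally_finite_borel_measure_on X M \<Longrightarrow> space M = X"
  using sets_eq_imp_space_eq[of M "restrict_space borel X"]
  by (simp add: locally_finite_borel_measure_on_def space_restrict_space)

text \<open>Finitely many open sets with traces of finite measure cover \<open>K\<close>. That
  \<open>K\<close> is Borel is assumed because compact sets need not be closed in a general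
  topological space.\<close>

lemma locally_finite_compact:
  assumes M: "locally_finite_borel_measure_on X M" and K: "compact K" "K \<subseteq> X"
    and "K \<in> sets borel"
  shows "K \<in> sets M" "emeasure M K < \<infinity>"
proof -
  have sets: "sets M = sets (restrict_space borel X)"
    using M by (simp add: locally_finite_borel_measure_on_def)
  show KM: "K \<in> sets M" using assms by (auto simp: sets sets_restrict_space)
  have "\<forall>x\<in>K. \<exists>U. open U \<and> x \<in> U \<and> emeasure M (U \<inter> X) < \<infinity>"
    using M K by (auto simp: locally_finite_borel_measure_on_def)
  then obtain U where U: "\<And>x. x \<in> K \<Longrightarrow> open (U x) \<and> x \<in> U x \<and> emeasure M (U x \<inter> X) < \<infinity>"
    by metis
  then obtain C where C: "C \<subseteq> K" "finite C" "K \<subseteq> (\<Union>x\<in>C. U x)"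
    using compactE_image[OF K(1), of K U] by (metis UN_I subsetI)
  have UM: "U x \<inter> X \<in> sets M" if "x \<in> K" for x
    using U[OF that] by (auto simp: sets sets_restrict_space)
  have "emeasure M K \<le> emeasure M (\<Union>x\<in>C. U x \<inter> X)"
  proof (rule emeasure_mono)
    show "K \<subseteq> (\<Union>x\<in>C. U x \<inter> X)" using C K by blast
    show "(\<Union>x\<in>C. U x \<inter> X) \<in> sets M" using C UM by (intro sets.finite_UN) auto
  qed
  also have "\<dots> \<le> (\<Sum>x\<in>C. emeasure M (U x \<inter> X))"
    by (rule emeasure_subadditive_finite) (use C UM in auto)
  also have "\<dots> < \<infinity>"
    using C U by (auto simp: less_top)
  finally show "emeasure M K < \<infinity>" .
qed

lemma continuous_borel_measurable_on:
  fixes u :: "'x::topological_space \<Rightarrow> 'y::topological_space"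
  assumes "locally_finite_borel_measure_on X M" "continuous_on X u"
  shows "u \<in> borel_measurable M"
  using borel_measurable_continuous_on_restrict[OF assms(2)] assms(1)
  by (simp add: locally_finite_borel_measure_on_def cong: measurable_cong_sets)

text \<open>The function is bounded on \<open>K\<close>, which has finite measure, and zero
  elsewhere on \<open>X\<close>. Any compact \<open>K\<close> containing the nonvanishing points
  serves; it need not be the exact support.\<close>

lemma integrable_continuous_compact_support:
  fixes u :: "'x::t2_space \<Rightarrow> real"
  assumes M: "locally_finite_borel_measure_on X M" and u: "continuous_on X u"
    and K: "compact K" "K \<subseteq> X" and zero: "\<And>x. x \<in> X - K \<Longrightarrow> u x = 0"
  shows "integrable M u"
proof -
  have "K \<in> sets borel" using K(1) by (simp add: borel_closed compact_imp_closed)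
  note KM = locally_finite_compact[OF M K this]
  have "bounded (u ` K)"
    using K u by (meson compact_continuous_image compact_imp_bounded continuous_on_subset)
  then obtain C where "\<And>x. x \<in> K \<Longrightarrow> norm (u x) \<le> C" by (auto simp: bounded_iff)
  then show ?thesis
    using KM zero space_locally_finite[OF M]
    by (intro integrableI_bounded_set[of K M u C] continuous_borel_measurable_on[OF M u]) auto
qed

section \<open>Lifting functions from an orbit to the group\<close>

lemma continuous_left_actionD:
  assumes "continuous_left_action act"
  shows "act 0 x = x" "act (g + h) x = act g (act h x)" "continuous_on UNIV (\<lambda>g. act g x)"
proof -
  have "continuous_on UNIV (\<lambda>(g, x). act g x)"
    using assms by (simp add: continuous_left_action_def)
  moreover have "continuous_on UNIV (\<lambda>g. (g, x))" by (intro continuous_intros)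
  ultimately show "continuous_on UNIV (\<lambda>g. act g x)"
    using continuous_on_compose2[of UNIV "\<lambda>(g, x). act g x" UNIV "\<lambda>g. (g, x)"] by simp
qed (use assms in \<open>simp_all add: continuous_left_action_def\<close>)

text \<open>The data for one index at a fixed base point: \<open>d\<close> stands for \<delta>(-,b),
  \<open>g\<close> for a functional applied to the kernel acting on the section, and
  \<open>D\<close>, \<open>K\<close> are compact sets outside which these vanish.\<close>

locale orbit_lift =
  fixes act :: "'g::{topological_group_add, t2_space} \<Rightarrow> 'b::t2_space \<Rightarrow> 'b"
    and b :: 'b
    and \<phi> :: "'b \<times> 'b \<Rightarrow> real" and \<theta> :: "'b \<times> 'b \<Rightarrow> 'g"
    and d :: "'g \<Rightarrow> real" and D :: "'g set"
    and g :: "'b \<Rightarrow> real" and K :: "'b set"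
  assumes act: "continuous_left_action act"
    and phi_continuous: "continuous_on (orbit_pairs act) \<phi>"
    and phi_nonneg: "\<And>x. x \<in> orbit_pairs act \<Longrightarrow> 0 \<le> \<phi> x"
    and theta_continuous: "continuous_on (U_closure act \<phi>) \<theta>"
    and theta_act: "\<And>c. (c, b) \<in> U_closure act \<phi> \<Longrightarrow> act (\<theta> (c, b)) b = c"
    and d_continuous: "continuous_on (action_stabilizer act b) d"
    and D: "compact D" "\<And>h. h \<in> action_stabilizer act b - D \<Longrightarrow> d h = 0"
    and g_continuous: "continuous_on (action_orbit act b) g"
    and K: "compact K" "K \<subseteq> action_orbit act b" "\<And>c. c \<in> action_orbit act b - K \<Longrightarrow> g c = 0"
begin

definition lift :: "'g \<Rightarrow> real" where
  "lift k = (if (act k b, b) \<in> U_closure act \<phi>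
    then d (- \<theta> (act k b, b) + k) * \<phi> (act k b, b) * g (act k b) else 0)"

section \<open>Continuity and compact support of the lifted function\<close>

lemma orbit_pair: "(act k b, b) \<in> orbit_pairs act"
  by (auto simp: orbit_pairs_def action_orbit_def)

lemma continuous_orbit_pair: "continuous_on S (\<lambda>k. (act k b, b))"
  using continuous_left_actionD(3)[OF act, of b]
  by (intro continuous_intros) (auto intro: continuous_on_subset)

lemma U_closure_iff:
  "x \<in> orbit_pairs act \<Longrightarrow> x \<in> U_closure act \<phi> \<longleftrightarrow> x \<in> closure {x \<in> orbit_pairs act. 0 < \<phi> x}"
  by (simp add: U_closure_def)

lemma phi_eq_0:
  assumes "x \<in> orbit_pairs act" "x \<notin> U_closure act \<phi>"
  shows "\<phi> x = 0"
proof (rule ccontr)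
  assume "\<phi> x \<noteq> 0"
  then have "x \<in> {x \<in> orbit_pairs act. 0 < \<phi> x}"
    using phi_nonneg[OF assms(1)] assms(1) by auto
  then have "x \<in> closure {x \<in> orbit_pairs act. 0 < \<phi> x}"
    by (rule subsetD[OF closure_subset])
  then show False using assms by (simp add: U_closure_iff)
qed

text \<open>Both \<open>k\<close> and \<open>\<theta> (act k b, b)\<close> carry \<open>b\<close> to
  \<open>act k b\<close>, so their quotient fixes \<open>b\<close>. This puts the argument of
  \<open>d\<close> where its continuity and support are known.\<close>

lemma theta_stabilizer:
  assumes "(act k b, b) \<in> U_closure act \<phi>"
  shows "- \<theta> (act k b, b) + k \<in> action_stabilizer act b"
proof -
  have "act (- \<theta> (act k b, b) + k) b = act (- \<theta> (act k b, b)) (act (\<theta> (act k b, b)) b)"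
    using theta_act[OF assms] by (simp add: continuous_left_actionD(2)[OF act])
  also have "\<dots> = b"
    by (simp flip: continuous_left_actionD(2)[OF act] add: continuous_left_actionD(1)[OF act])
  finally show ?thesis by (simp add: action_stabilizer_def)
qed

lemma lift_continuous: "continuous_on UNIV lift"
proof -
  let ?A = "{k. (act k b, b) \<in> U_closure act \<phi>}" and ?Z = "{k. \<phi> (act k b, b) = 0}"
  \<comment> \<open>\<open>U_closure\<close> is a closure relative to the orbit pairs; since every
    \<open>(act k b, b)\<close> is such a pair, the ambient closure has the same preimage, which is
    closed.\<close>
  have "?A = (\<lambda>k. (act k b, b)) -` closure {x \<in> orbit_pairs act. 0 < \<phi> x}"
    using U_closure_iff orbit_pair by auto
  then have A: "closed ?A" by (simp add: closed_vimage continuous_orbit_pair)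
  have phi: "continuous_on UNIV (\<lambda>k. \<phi> (act k b, b))"
    by (rule continuous_on_compose2[OF phi_continuous continuous_orbit_pair])
      (auto simp: orbit_pair)
  then have Z: "closed ?Z" by (intro closed_Collect_eq) auto
  have theta: "continuous_on ?A (\<lambda>k. \<theta> (act k b, b))"
    by (rule continuous_on_compose2[OF theta_continuous continuous_orbit_pair]) auto
  have "continuous_on ?A (\<lambda>k. - \<theta> (act k b, b) + k)"
    by (intro continuous_intros theta)
  then have d: "continuous_on ?A (\<lambda>k. d (- \<theta> (act k b, b) + k))"
    by (rule continuous_on_compose2[OF d_continuous]) (auto simp: theta_stabilizer)
  have g: "continuous_on ?A (\<lambda>k. g (act k b))"
    by (rule continuous_on_compose2[OF g_continuous
          continuous_on_subset[OF continuous_left_actionD(3)[OF act]]])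
      (auto simp: action_orbit_def)
  \<comment> \<open>Gluing over two closed sets that cover the group: on the overlap the factor
    \<phi> is zero, so both branches agree.\<close>
  have "continuous_on (?A \<union> ?Z) lift"
    unfolding lift_def
    by (rule continuous_on_If[OF A Z])
      (auto intro!: continuous_on_mult d g continuous_on_subset[OF phi] continuous_on_const)
  moreover have "?A \<union> ?Z = UNIV" using phi_eq_0 orbit_pair by blast
  ultimately show ?thesis by simp
qed

text \<open>The ambient closure replaces \<open>U_closure\<close> here because intersecting it with
  \<open>K\<close> gives a compact set, whereas the set of orbit pairs need not be closed. The two
  agree over \<open>K\<close>, which lies in the orbit.\<close>

definition lift_support :: "'g set" where
  "lift_support = (\<lambda>(c, s). \<theta> (c, b) + s) `
    ((K \<inter> {c. (c, b) \<in> closure {x \<in> orbit_pairs act. 0 < \<phi> x}}) \<times> D)"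

lemma compact_lift_support: "compact lift_support"
proof -
  let ?K = "K \<inter> {c. (c, b) \<in> closure {x \<in> orbit_pairs act. 0 < \<phi> x}}"
  have "closed ((\<lambda>c. (c, b)) -` closure {x \<in> orbit_pairs act. 0 < \<phi> x})"
    by (rule closed_vimage[OF closed_closure]) (intro continuous_intros)
  then have "compact ?K" using K(1) by (simp add: compact_Int_closed vimage_def)
  then have "compact (?K \<times> D)" using D(1) by (rule compact_Times)
  moreover have "?K \<times> {b} \<subseteq> U_closure act \<phi>"
    using K(2) by (auto simp: U_closure_def orbit_pairs_def)
  then have "continuous_on (?K \<times> D) (\<lambda>z. \<theta> (fst z, b))"
    by (intro continuous_on_compose2[OF theta_continuous, of _ "\<lambda>z. (fst z, b)"] continuous_intros) auto
  then have "continuous_on (?K \<times> D) (\<lambda>z. \<theta> (fst z, b) + snd z)"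
    by (intro continuous_intros)
  ultimately show ?thesis
    unfolding lift_support_def case_prod_beta by (rule compact_continuous_image[rotated])
qed

lemma lift_eq_0:
  assumes "k \<notin> lift_support"
  shows "lift k = 0"
proof (rule ccontr)
  assume nz: "lift k \<noteq> 0"
  let ?c = "act k b"
  from nz have c: "(?c, b) \<in> U_closure act \<phi>" "d (- \<theta> (?c, b) + k) \<noteq> 0" "g ?c \<noteq> 0"
    by (auto simp: lift_def split: if_splits)
  then have "- \<theta> (?c, b) + k \<in> D" "?c \<in> K"
    using D(2) K(3) theta_stabilizer by (auto simp: action_orbit_def)
  \<comment> \<open>This factorization exhibits \<open>k\<close> as the image of a point of
    \<open>K\<close> paired with a point of \<open>D\<close>.\<close>
  moreover have "k = \<theta> (?c, b) + (- \<theta> (?c, b) + k)" by (simp flip: add.assoc)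
  ultimately have "k \<in> lift_support"
    using c(1) unfolding lift_support_def U_closure_def by (intro image_eqI[of _ _ "(?c, - \<theta> (?c, b) + k)"]) auto
  then show False using assms by simp
qed

lemma lift_compactly_supported: "compactly_supported_on UNIV (\<lambda>k. lift k \<noteq> 0)"
proof -
  have "closure {k. lift k \<noteq> 0} \<subseteq> lift_support"
    using lift_eq_0 compact_lift_support by (intro closure_minimal compact_imp_closed) auto
  then have "closure {k. lift k \<noteq> 0} = lift_support \<inter> closure {k. lift k \<noteq> 0}" by blast
  then show ?thesis
    unfolding compactly_supported_on_def using compact_lift_support compact_Int_closed[of lift_support]
    by (metis (no_types, lifting) Collect_cong UNIV_I closed_closure inf_top_left)
qed

section \<open>Integration of the lifted function along the orbit map\<close>

lemma integrable_lift: "locally_finite_borel_measure_on UNIV M \<Longrightarrow> integrable M lift"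
  by (rule integrable_continuous_compact_support[OF _ lift_continuous compact_lift_support])
    (auto simp: lift_eq_0)

lemma integrable_weighted:
  assumes "locally_finite_borel_measure_on (action_orbit act b) M"
  shows "integrable M (\<lambda>c. \<phi> (c, b) * g c)"
proof (rule integrable_continuous_compact_support[OF assms _ K(1,2)])
  have "continuous_on (action_orbit act b) (\<lambda>c. \<phi> (c, b))"
    by (rule continuous_on_compose2[OF phi_continuous])
      (auto intro!: continuous_intros simp: orbit_pairs_def)
  then show "continuous_on (action_orbit act b) (\<lambda>c. \<phi> (c, b) * g c)"
    by (intro continuous_intros g_continuous)
qed (simp add: K(3))

text \<open>On the coset of \<open>k\<close> the orbit point stays at \<open>act k b\<close>, so
  \<phi> and \<open>g\<close> are constant and only a translate of \<open>d\<close> is integrated.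
  If the pair lies outside \<open>U_closure\<close>, both sides vanish, since \<phi> is zero
  there.\<close>

lemma integral_fiber_lift:
  assumes N: "locally_finite_borel_measure_on (action_stabilizer act b) N"
    and inv: "\<And>k. k \<in> action_stabilizer act b \<Longrightarrow> distr N N (\<lambda>h. k + h) = N"
    and one: "(\<integral>h. d h \<partial>N) = 1"
  shows "(\<integral>h. lift (k + h) \<partial>N) = \<phi> (act k b, b) * g (act k b)"
proof (cases "(act k b, b) \<in> U_closure act \<phi>")
  case True
  let ?s = "- \<theta> (act k b, b) + k"
  have s: "?s \<in> action_stabilizer act b" using theta_stabilizer[OF True] .
  have stab: "act (k + h) b = act k b" if "h \<in> action_stabilizer act b" for h
    using that by (simp add: action_stabilizer_def continuous_left_actionD(2)[OF act])
  have sets: "sets N = sets (restrict_space borel (action_stabilizer act b))"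
    using N by (simp add: locally_finite_borel_measure_on_def)
  have "(\<lambda>h. ?s + h) \<in> restrict_space borel (action_stabilizer act b) \<rightarrow>\<^sub>M
      restrict_space borel (action_stabilizer act b)"
    using s by (intro measurable_restrict_space3 borel_measurable_continuous_onI continuous_intros)
      (auto simp: action_stabilizer_def continuous_left_actionD(2)[OF act])
  then have meas: "(\<lambda>h. ?s + h) \<in> N \<rightarrow>\<^sub>M N"
    using measurable_cong_sets[OF sets sets] by simp
  have "(\<integral>h. lift (k + h) \<partial>N) = (\<integral>h. d (?s + h) * (\<phi> (act k b, b) * g (act k b)) \<partial>N)"
    by (rule Bochner_Integration.integral_cong)
      (auto simp: lift_def stab True space_locally_finite[OF N] add.assoc)
  also have "\<dots> = (\<integral>h. d (?s + h) \<partial>N) * (\<phi> (act k b, b) * g (act k b))"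
    by simp
  \<comment> \<open>Change of variables: the pushforward on the right is \<open>N\<close> itself,
    because \<open>?s\<close> is in the stabilizer.\<close>
  also have "(\<integral>h. d (?s + h) \<partial>N) = (\<integral>h. d h \<partial>distr N N (\<lambda>h. ?s + h))"
    by (rule integral_distr[symmetric, OF meas continuous_borel_measurable_on[OF N d_continuous]])
  finally show ?thesis by (simp add: inv[OF s] one)
next
  case False
  have "(\<integral>h. lift (k + h) \<partial>N) = (\<integral>h. 0 \<partial>N)"
    by (rule Bochner_Integration.integral_cong)
      (use False in \<open>auto simp: lift_def space_locally_finite[OF N] action_stabilizer_def continuous_left_actionD(2)[OF act]\<close>)
  then show ?thesis using phi_eq_0[OF orbit_pair False] by simp
qed

lemma integral_lift:
  assumes N: "locally_finite_borel_measure_on (action_stabilizer act b) N"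
    and inv: "\<And>k. k \<in> action_stabilizer act b \<Longrightarrow> distr N N (\<lambda>h. k + h) = N"
    and one: "(\<integral>h. d h \<partial>N) = 1"
    and M: "locally_finite_borel_measure_on (action_orbit act b) M"
    and decomposition: "\<And>(f' :: 'g \<Rightarrow> real) k. continuous_on UNIV f' \<Longrightarrow>
        compactly_supported_on UNIV (\<lambda>h. f' h \<noteq> 0) \<Longrightarrow>
        (\<And>c. c \<in> action_orbit act b \<Longrightarrow> act (k c) b = c) \<Longrightarrow>
        (\<integral>h. f' h \<partial>L) = (\<integral>c. (\<integral>h. f' (k c + h) \<partial>N) \<partial>M)"
  shows "(\<integral>k. lift k \<partial>L) = (\<integral>c. \<phi> (c, b) * g c \<partial>M)"
proof -
  \<comment> \<open>The decomposition admits any selection of representatives, so one obtained by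
    choice suffices.\<close>
  have "\<forall>c\<in>action_orbit act b. \<exists>k. act k b = c" by (auto simp: action_orbit_def)
  then obtain k where k: "\<And>c. c \<in> action_orbit act b \<Longrightarrow> act (k c) b = c" by metis
  have "(\<integral>k. lift k \<partial>L) = (\<integral>c. (\<integral>h. lift (k c + h) \<partial>N) \<partial>M)"
    by (rule decomposition[OF lift_continuous lift_compactly_supported k])
  also have "\<dots> = (\<integral>c. \<phi> (c, b) * g c \<partial>M)"
    by (rule Bochner_Integration.integral_cong)
      (auto simp: integral_fiber_lift[OF N inv one] k space_locally_finite[OF M])
  finally show ?thesis .
qed

end

section \<open>Orbitwise transform and cross-correlation\<close>

text \<open>Local finiteness gives each point of \<open>K\<close> a neighbourhood meeting finitely
  many \<phi>; a finite subcover leaves finitely many indices over all of \<open>K\<close>.\<close>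

lemma partition_of_unity_compact:
  assumes P: "invariant_partition_of_unity act I \<phi>"
    and K: "compact K" "K \<subseteq> action_orbit act b"
  shows finite_partition_compact: "finite {i \<in> I. \<exists>c\<in>K. \<phi> i (c, b) \<noteq> 0}"
    and sum_partition_compact: "c \<in> K \<Longrightarrow> (\<Sum>i\<in>{i \<in> I. \<exists>c\<in>K. \<phi> i (c, b) \<noteq> 0}. \<phi> i (c, b)) = 1"
proof -
  let ?T = "{i \<in> I. \<exists>c\<in>K. \<phi> i (c, b) \<noteq> 0}"
  have Kb: "(c, b) \<in> orbit_pairs act" if "c \<in> K" for c
    using that K by (auto simp: orbit_pairs_def)
  have "\<forall>c\<in>K. \<exists>N. open N \<and> (c, b) \<in> N \<and>
      finite {i \<in> I. \<exists>y\<in>N \<inter> orbit_pairs act. \<phi> i y \<noteq> 0}"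
    using P Kb by (auto simp: invariant_partition_of_unity_def)
  from bchoice[OF this] obtain N where "\<forall>c\<in>K. open (N c) \<and> (c, b) \<in> N c \<and>
      finite {i \<in> I. \<exists>y\<in>N c \<inter> orbit_pairs act. \<phi> i y \<noteq> 0}" ..
  note N = bspec[OF this]
  have "open ((\<lambda>c. (c, b)) -` N c)" if "c \<in> K" for c
    using N[OF that] by (intro open_vimage continuous_intros) auto
  then obtain C where C: "C \<subseteq> K" "finite C" "K \<subseteq> (\<Union>c\<in>C. (\<lambda>c. (c, b)) -` N c)"
    using N by (elim compactE_image[OF K(1), of K "\<lambda>c. (\<lambda>c. (c, b)) -` N c", rotated -1]) auto
  have "?T \<subseteq> (\<Union>c\<in>C. {i \<in> I. \<exists>y\<in>N c \<inter> orbit_pairs act. \<phi> i y \<noteq> 0})"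
    using C(3) Kb by fastforce
  then show fin: "finite ?T"
    by (rule finite_subset) (use C N in auto)
  show "(\<Sum>i\<in>?T. \<phi> i (c, b)) = 1" if "c \<in> K"
  proof -
    have "supp_sum (\<lambda>i. \<phi> i (c, b)) I = 1"
      using P Kb[OF that] by (simp add: invariant_partition_of_unity_def)
    then have "(\<Sum>i\<in>{i \<in> I. \<phi> i (c, b) \<noteq> 0}. \<phi> i (c, b)) = 1"
      by (simp add: supp_sum_def support_on_def)
    \<comment> \<open>The additional indices contribute zero at \<open>c\<close>, so one finite
      index set serves all points of \<open>K\<close>.\<close>
    moreover have "(\<Sum>i\<in>{i \<in> I. \<phi> i (c, b) \<noteq> 0}. \<phi> i (c, b)) = (\<Sum>i\<in>?T. \<phi> i (c, b))"
      by (rule sum.mono_neutral_left[OF fin]) (use that in auto)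
    ultimately show ?thesis by simp
  qed
qed

theorem theorem4p15:
  fixes actB :: "'g::{topological_group_add, t2_space} \<Rightarrow> 'b::t2_space \<Rightarrow> 'b"
    and actE :: "'g \<Rightarrow> 'e::topological_space \<Rightarrow> 'e"
    and pE :: "'e \<Rightarrow> 'b" and VE :: "'b \<Rightarrow> (real, 'e) module"
    and actF :: "'g \<Rightarrow> 'f::topological_space \<Rightarrow> 'f"
    and pF :: "'f \<Rightarrow> 'b" and VF :: "'b \<Rightarrow> (real, 'f) module"
    and mu :: "'b \<Rightarrow> 'g measure"
    and mubar :: "'b \<Rightarrow> 'b measure"
    and nu :: "'b \<Rightarrow> 'g measure"
    and \<delta> :: "'g \<Rightarrow> 'b \<Rightarrow> real"
    and \<kappa> :: "'b \<Rightarrow> 'b \<Rightarrow> 'e \<Rightarrow> 'f"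
    and I :: "'i set"
    and \<phi> :: "'i \<Rightarrow> 'b \<times> 'b \<Rightarrow> real"
    and \<theta> :: "'i \<Rightarrow> 'b \<times> 'b \<Rightarrow> 'g"
    and \<omega> :: "'g \<Rightarrow> 'b \<Rightarrow> 'e \<Rightarrow> 'f"
    and f :: "'b \<Rightarrow> 'e" and ft :: "'g \<Rightarrow> 'b \<Rightarrow> 'e"
    and b :: 'b
  assumes actB: "continuous_left_action actB"
    and bundle_E: "equivariant_vector_bundle actB actE pE VE"
    and bundle_F: "equivariant_vector_bundle actB actF pF VF"
    \<comment> \<open>the measures\<close>
    and mu: "\<And>b. locally_finite_borel_measure_on UNIV (mu b)"
    and mubar: "\<And>b. locally_finite_borel_measure_on (action_orbit actB b) (mubar b)"
    and nu: "\<And>b. locally_finite_borel_measure_on (action_stabilizer actB b) (nu b)"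
    and nu_left_invariant:
      "\<And>b k. k \<in> action_stabilizer actB b \<Longrightarrow> distr (nu b) (nu b) (\<lambda>h. k + h) = nu b"
    and mu_equivariant:
      "\<And>g b. mu (actB g b) = distr (mu b) borel (\<lambda>h. g + h - g)"
    and nu_equivariant:
      "\<And>g b. nu (actB g b) =
        distr (nu b) (restrict_space borel (action_stabilizer actB (actB g b))) (\<lambda>h. g + h - g)"
    and mubar_equivariant:
      "\<And>g b. mubar (actB g b) =
        distr (mubar b) (restrict_space borel (action_orbit actB (actB g b))) (actB g)"
    and mu_continuous:
      "\<And>f' :: 'g \<Rightarrow> real. continuous_on UNIV f' \<Longrightarrow> compactly_supported_on UNIV (\<lambda>h. f' h \<noteq> 0) \<Longrightarrow>
        continuous_on UNIV (\<lambda>b. \<integral>h. f' h \<partial>mu b)"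
    and mu_decomposition:
      "\<And>b (f' :: 'g \<Rightarrow> real) k. continuous_on UNIV f' \<Longrightarrow> compactly_supported_on UNIV (\<lambda>h. f' h \<noteq> 0) \<Longrightarrow>
        (\<And>c. c \<in> action_orbit actB b \<Longrightarrow> actB (k c) b = c) \<Longrightarrow>
        (\<integral>h. f' h \<partial>mu b) = (\<integral>c. (\<integral>h. f' (k c + h) \<partial>nu b) \<partial>mubar b)"
    \<comment> \<open>the function \<open>\<delta>\<close>\<close>
    and delta_continuous:
      "continuous_on {(h, b). h \<in> action_stabilizer actB b} (\<lambda>(h, b). \<delta> h b)"
    and delta_nonneg: "\<And>h b. h \<in> action_stabilizer actB b \<Longrightarrow> 0 \<le> \<delta> h b"
    and delta_support:
      "\<And>b. compactly_supported_on (action_stabilizer actB b) (\<lambda>h. \<delta> h b \<noteq> 0)"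
    and delta_integral: "\<And>b. (\<integral>h. \<delta> h b \<partial>nu b) = 1"
    and delta_invariant:
      "\<And>g b h. h \<in> action_stabilizer actB b \<Longrightarrow> \<delta> (g + h - g) (actB g b) = \<delta> h b"
    \<comment> \<open>the kernel\<close>
    and kappa_linear:
      "\<And>c b. c \<in> action_orbit actB b \<Longrightarrow> fiber_linear (VE c) (VF b) (\<kappa> c b)"
    and kappa_continuous:
      "continuous_map (top_of_set (orbit_pairs actB)) (hom_topology pE VE pF VF)
        (\<lambda>(c, b). ((c, b), restrict (\<kappa> c b) (carrier (VE c))))"
    and kappa_support:
      "\<And>b. compactly_supported_on (action_orbit actB b)
        (\<lambda>c. \<exists>v\<in>carrier (VE c). \<kappa> c b v \<noteq> \<zero>\<^bsub>VF b\<^esub>)"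
    and kappa_equivariant:
      "\<And>g b c v. c \<in> action_orbit actB b \<Longrightarrow> v \<in> carrier (VE c) \<Longrightarrow>
        actF g (\<kappa> c b v) = \<kappa> (actB g c) (actB g b) (actE g v)"
    \<comment> \<open>the partition of unity and the maps \<open>\<theta>\<^sub>i\<close>\<close>
    and partition: "invariant_partition_of_unity actB I \<phi>"
    and theta_continuous:
      "\<And>i. i \<in> I \<Longrightarrow> continuous_on (U_closure actB (\<phi> i)) (\<theta> i)"
    and theta_act:
      "\<And>i c b. i \<in> I \<Longrightarrow> (c, b) \<in> U_closure actB (\<phi> i) \<Longrightarrow> c = actB (\<theta> i (c, b)) b"
    and theta_equivariant:
      "\<And>g i c b. i \<in> I \<Longrightarrow> (c, b) \<in> U_closure actB (\<phi> i) \<Longrightarrow>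
        g + \<theta> i (c, b) = \<theta> i (actB g c, actB g b) + g"
    \<comment> \<open>the data of the theorem\<close>
    and omega: "\<omega> = omega actB actE VE VF \<delta> \<kappa> I \<phi> \<theta>"
    and section_f: "continuous_section pE f"
    and mackey: "ft = mackey_section actB actE f"
  shows "fiber_integrable (mu b) (VF b) (\<lambda>k. \<omega> k b (ft (0 + k) b)) \<and>
    fiber_integrable (mubar b) (VF b) (\<lambda>c. \<kappa> c b (f c)) \<and>
    cross_correlation mu VF \<omega> ft 0 b = integral_transform mubar VF \<kappa> f b"
proof -
  let ?O = "action_orbit actB b" and ?S = "action_stabilizer actB b"
  let ?A = "{c \<in> ?O. \<exists>v\<in>carrier (VE c). \<kappa> c b v \<noteq> \<zero>\<^bsub>VF b\<^esub>}"
  define K where "K = ?O \<inter> closure ?A"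
  define D where "D = ?S \<inter> closure {h \<in> ?S. \<delta> h b \<noteq> 0}"
  \<comment> \<open>\<open>T\<close> may be larger than the index set \<open>J\<close> of the sum defining \<open>\<omega>\<close>, but it is still
    finite, and on \<open>K\<close> the \<open>\<phi> i\<close> with \<open>i\<in>T\<close> visibly sum to 1.\<close>
  define T where "T = {i \<in> I. \<exists>c\<in>K. \<phi> i (c, b) \<noteq> 0}"
  let ?part = "\<lambda>i. omega_part actB actE VF \<delta> \<kappa> (\<phi> i) (\<theta> i)"
  define J where "J = {i \<in> I. \<exists>h. \<exists>v\<in>carrier (VE b). ?part i h b v \<noteq> \<zero>\<^bsub>VF b\<^esub>}"
  have E: "real_vector_bundle pE VE" and F: "real_vector_bundle pF VF"
    using bundle_E bundle_F by (simp_all add: equivariant_vector_bundle_def)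
  have carE: "x \<in> carrier (VE c) \<longleftrightarrow> pE x = c" for x c
    using E by (auto simp: real_vector_bundle_def)
  have modF: "Module.module real_field_ring (VF b)"
    using F by (simp add: real_vector_bundle_def)
  interpret F: Module.module real_field_ring "VF b" by (rule modF)
  have pE_act: "pE (actE g x) = actB g (pE x)" for g x
    using bundle_E by (simp add: equivariant_vector_bundle_def)
  have actE: "continuous_left_action actE"
    using bundle_E by (simp add: equivariant_vector_bundle_def)
  have f: "f c \<in> carrier (VE c)" for c
    using section_f by (simp add: carE continuous_section_def)
  have orbit: "actB k b \<in> ?O" for k by (simp add: action_orbit_def)
  have K: "compact K" "K \<subseteq> ?O"
    using kappa_support[of b] by (auto simp: K_def compactly_supported_on_def)
  have kappa_0: "\<kappa> c b v = \<zero>\<^bsub>VF b\<^esub>" if "c \<in> ?O - K" "v \<in> carrier (VE c)" for c v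
    using that subsetD[OF closure_subset, of c ?A] by (auto simp: K_def)
  have D: "compact D" "\<And>h. h \<in> ?S - D \<Longrightarrow> \<delta> h b = 0"
    using delta_support[of b] subsetD[OF closure_subset, of _ "{h \<in> ?S. \<delta> h b \<noteq> 0}"]
    by (auto simp: D_def compactly_supported_on_def)
  have T: "finite T" "\<And>c. c \<in> K \<Longrightarrow> (\<Sum>i\<in>T. \<phi> i (c, b)) = 1"
    unfolding T_def using partition_of_unity_compact[OF partition K] by auto
  have TI: "T \<subseteq> I" by (auto simp: T_def)
  have kappa: "\<kappa> c b v \<in> carrier (VF b)" if "c \<in> ?O" "v \<in> carrier (VE c)" for c v
    using kappa_linear[OF that(1)] that(2) by (auto simp: fiber_linear_def)
  have act_carE: "actE k v \<in> carrier (VE (actB k b))" if "v \<in> carrier (VE b)" for k v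
    using that by (simp add: carE pE_act)
  have part_closed: "?part i k b v \<in> carrier (VF b)" if "v \<in> carrier (VE b)" for i k v
    using F.smult_closed kappa[OF orbit act_carE[OF that]]
    by (auto simp: omega_part_def real_field_ring_def)
  \<comment> \<open>A nonzero value at \<open>k\<close> forces both the kernel and \<phi> to be
    nonzero at \<open>actB k b\<close>; this is then a point of \<open>K\<close> witnessing
    membership in \<open>T\<close>. In particular \<open>J\<close> is finite, so
    \<open>finsum\<close> is a genuine sum.\<close>
  have "J \<subseteq> T"
  proof
    fix i assume "i \<in> J"
    then obtain k v where i: "i \<in> I" and v: "v \<in> carrier (VE b)"
      and nz: "?part i k b v \<noteq> \<zero>\<^bsub>VF b\<^esub>" by (auto simp: J_def)
    let ?c = "actB k b"
    have null: "r \<odot>\<^bsub>VF b\<^esub> \<zero>\<^bsub>VF b\<^esub> = \<zero>\<^bsub>VF b\<^esub>" for r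
      using F.smult_r_null[of r] by (simp add: real_field_ring_def)
    have null': "0 \<odot>\<^bsub>VF b\<^esub> w = \<zero>\<^bsub>VF b\<^esub>" if "w \<in> carrier (VF b)" for w
      using F.smult_l_null[OF that] by (simp add: real_field_ring_def)
    have "?c \<in> K"
      using nz kappa_0[OF _ act_carE[OF v]] orbit null by (fastforce simp: omega_part_def split: if_splits)
    moreover have "\<phi> i (?c, b) \<noteq> 0"
      using nz null' kappa[OF orbit act_carE[OF v]] by (auto simp: omega_part_def split: if_splits)
    ultimately show "i \<in> T" using i by (auto simp: T_def)
  qed
  have "continuous_on ?S (\<lambda>h. (h, b))" by (intro continuous_intros)
  from continuous_on_compose2[OF delta_continuous this]
  have delta: "continuous_on ?S (\<lambda>h. \<delta> h b)" by auto
  have ft: "ft k b \<in> carrier (VE b)" "actE k (ft k b) = f (actB k b)" for k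
  proof -
    have "pE (ft k b) = actB (- k + k) b"
      using f[of "actB k b"] continuous_left_actionD(2)[OF actB, of "- k" k b]
      by (simp add: carE mackey mackey_section_def pE_act)
    then show "ft k b \<in> carrier (VE b)"
      by (simp add: carE continuous_left_actionD(1)[OF actB])
    have "actE k (ft k b) = actE (k + - k) (f (actB k b))"
      by (simp only: continuous_left_actionD(2)[OF actE] mackey mackey_section_def)
    then show "actE k (ft k b) = f (actB k b)"
      by (simp add: continuous_left_actionD(1)[OF actE])
  qed
  have omega_eq: "\<omega> k b (ft k b) = finsum (VF b) (\<lambda>i. ?part i k b (ft k b)) J" for k
    by (simp add: omega omega_def J_def)
  have finJ: "finite J" using \<open>J \<subseteq> T\<close> T(1) by (rule finite_subset)

  \<comment> \<open>Integrability is proved along with the equality, since a fiber integral requires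
    it for every functional.\<close>
  have main: "integrable (mu b) (\<lambda>k. l (\<omega> k b (ft k b)))"
    "integrable (mubar b) (\<lambda>c. l (\<kappa> c b (f c)))"
    "(\<integral>k. l (\<omega> k b (ft k b)) \<partial>mu b) = (\<integral>c. l (\<kappa> c b (f c)) \<partial>mubar b)"
    if l: "fiber_functional (VF b) l" for l
  proof -
    define g where "g c = l (\<kappa> c b (f c))" for c
    have g_cont: "continuous_on ?O g"
      using hom_section_apply_continuous[OF E F _ kappa_continuous section_f l] kappa_linear
      by (simp add: orbit_pairs_def g_def[abs_def])
    have g_0: "g c = 0" if "c \<in> ?O - K" for c
      using kappa_0[OF that f] module_functional_zero[OF modF l] by (simp add: g_def)
    have lift: "orbit_lift actB b (\<phi> i) (\<theta> i) (\<lambda>h. \<delta> h b) D g K" if "i \<in> I" for i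
    proof
      show "continuous_on (orbit_pairs actB) (\<phi> i)" "\<And>x. x \<in> orbit_pairs actB \<Longrightarrow> 0 \<le> \<phi> i x"
        using partition that by (auto simp: invariant_partition_of_unity_def)
      show "\<And>c. (c, b) \<in> U_closure actB (\<phi> i) \<Longrightarrow> actB (\<theta> i (c, b)) b = c"
        using theta_act[OF that] by metis
    qed (use actB theta_continuous[OF that] delta D g_cont K g_0 in auto)
    let ?u = "\<lambda>i. orbit_lift.lift actB b (\<phi> i) (\<theta> i) (\<lambda>h. \<delta> h b) g"
    have l_part: "l (?part i k b (ft k b)) = ?u i k" if "i \<in> I" for i k
      using l kappa[OF orbit f] module_functional_zero[OF modF l]
      by (simp add: orbit_lift.lift_def[OF lift[OF that]] omega_part_def ft g_def fiber_functional_def)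
    have l_omega: "l (\<omega> k b (ft k b)) = (\<Sum>i\<in>T. ?u i k)" for k
    proof -
      have "l (\<omega> k b (ft k b)) = (\<Sum>i\<in>J. l (?part i k b (ft k b)))"
        unfolding omega_eq
        by (rule module_functional_finsum[OF modF l]) (auto simp: part_closed ft finJ)
      also have "\<dots> = (\<Sum>i\<in>T. l (?part i k b (ft k b)))"
      \<comment> \<open>An index of \<open>T\<close> outside \<open>J\<close> belongs to a part that
        is identically zero over \<open>b\<close>, so it may be added.\<close>
      proof (rule sum.mono_neutral_left[OF T(1) \<open>J \<subseteq> T\<close>], rule ballI)
        fix i assume "i \<in> T - J"
        then have "?part i k b (ft k b) = \<zero>\<^bsub>VF b\<^esub>"
          using TI ft(1)[of k] unfolding J_def by blast
        then show "l (?part i k b (ft k b)) = 0"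
          by (simp add: module_functional_zero[OF modF l])
      qed
      also have "\<dots> = (\<Sum>i\<in>T. ?u i k)"
        using TI by (intro sum.cong) (auto simp: l_part)
      finally show ?thesis .
    qed
    have int_u: "integrable (mu b) (?u i)" if "i \<in> T" for i
      using orbit_lift.integrable_lift[OF lift mu] that TI by auto
    show "integrable (mu b) (\<lambda>k. l (\<omega> k b (ft k b)))"
      unfolding l_omega by (intro Bochner_Integration.integrable_sum int_u)
    show "integrable (mubar b) (\<lambda>c. l (\<kappa> c b (f c)))"
      using integrable_continuous_compact_support[OF mubar g_cont K g_0] by (simp add: g_def)
    have "(\<integral>k. l (\<omega> k b (ft k b)) \<partial>mu b) = (\<Sum>i\<in>T. \<integral>k. ?u i k \<partial>mu b)"
      unfolding l_omega by (rule Bochner_Integration.integral_sum) (rule int_u)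
    also have "\<dots> = (\<Sum>i\<in>T. \<integral>c. \<phi> i (c, b) * g c \<partial>mubar b)"
      using TI by (intro sum.cong refl orbit_lift.integral_lift[OF lift nu nu_left_invariant
            delta_integral mubar mu_decomposition]) auto
    also have "\<dots> = (\<integral>c. (\<Sum>i\<in>T. \<phi> i (c, b) * g c) \<partial>mubar b)"
      using orbit_lift.integrable_weighted[OF lift mubar] TI
      by (intro Bochner_Integration.integral_sum[symmetric]) auto
    also have "\<dots> = (\<integral>c. g c \<partial>mubar b)"
    proof (rule Bochner_Integration.integral_cong[OF refl])
      fix c assume "c \<in> space (mubar b)"
      then have "c \<in> ?O" by (simp add: space_locally_finite[OF mubar])
      \<comment> \<open>On \<open>K\<close> the weights sum to 1; off \<open>K\<close> the factor
        \<open>g c\<close> is zero, whatever the weights sum to.\<close>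
      then show "(\<Sum>i\<in>T. \<phi> i (c, b) * g c) = g c"
        using T(2) g_0 by (cases "c \<in> K") (auto simp flip: sum_distrib_right)
    qed
    finally show "(\<integral>k. l (\<omega> k b (ft k b)) \<partial>mu b) = (\<integral>c. l (\<kappa> c b (f c)) \<partial>mubar b)"
      by (simp add: g_def)
  qed

  have kappa_f: "(\<lambda>c. \<kappa> c b (f c)) \<in> space (mubar b) \<rightarrow> carrier (VF b)"
    using kappa f by (auto simp: space_locally_finite[OF mubar])
  have "fiber_integrable (mubar b) (VF b) (\<lambda>c. \<kappa> c b (f c))"
    using F kappa_f main(2) by (rule fiber_integrableI)
  then obtain v where v: "has_fiber_integral (mubar b) (VF b) (\<lambda>c. \<kappa> c b (f c)) v"
    by (auto simp: fiber_integrable_def)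
  have "\<omega> k b (ft k b) \<in> carrier (VF b)" for k
    unfolding omega_eq by (rule F.finsum_closed) (auto simp: part_closed ft)
  \<comment> \<open>The vector \<open>v\<close> obtained on the orbit also integrates the
    correlation, as all functionals have equal integrals on both sides; uniqueness of fiber
    integrals then identifies both values with \<open>v\<close>.\<close>
  then have w: "has_fiber_integral (mu b) (VF b) (\<lambda>k. \<omega> k b (ft (0 + k) b)) v"
    using v main by (simp add: has_fiber_integral_def)
  show ?thesis
    using v w fiber_integral_eqI[OF F v] fiber_integral_eqI[OF F w]
    by (auto simp: fiber_integrable_def cross_correlation_def integral_transform_def)
qed

end
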